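(* For $i=1,2$, let $\Lambda_i\subset(0,\infty)$ be a countable multiplicative subgroup, let $\Gamma_i\subset\mathbb{R}$ be a countable $\mathbb{Z}\Lambda_i$-module which is dense in $\mathbb{R}$, and let $\mathcal{S}_i:=\mathcal{S}(\Gamma_i,\Lambda_i)$ be the Stein groupoid. If $\mathcal{S}_1$ is isomorphic to $\mathcal{S}_2$ and $\Lambda_1$ is finitely generated, then $\Lambda_1\cong\Lambda_2$ (as abelian groups).
   Context: "$\Gamma\subset\mathbb{R}$ is a $\mathbb{Z}\Lambda$-module" means that $\Gamma$ is an additive subgroup of $\mathbb{R}$ with $\lambda\Gamma\subset\Gamma$ for all $\lambda\in\Lambda$. The space $\mathbb{R}_\Gamma$: as a set $\mathbb{R}_\Gamma=(\mathbb{R}\setminus\Gamma)\sqcup\{t_+,t_-\mid t\in\Gamma\}$, with the canonical surjection $q:\mathbb{R}_\Gamma\to\mathbb{R}$ ($q(t_\pm)=t$, $q(x)=x$ for $x\notin\Gamma$), the total order such that $q(x)<q(y)$ implies $x<y$ and $t_-<t_+$ for $t\in\Gamma$, and the order topology. It is totally disconnected and locally compact Hausdorff; the sets $[t_+,s_-]$ ($t<s$ in $\Gamma$) are compact open and form a basis. The group $\Gamma\rtimes\Lambda$ (with $(s,\lambda)(s',\lambda')=(s+\lambda s',\lambda\lambda')$) acts on $\mathbb{R}_\Gamma$ by $(s,\lambda)\cdot x=\lambda x+s$ for $x\in\mathbb{R}\setminus\Gamma$ and $(s,\lambda)\cdot t_\pm=(\lambda t+s)_\pm$. For an action of a discrete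 group $G$ on $X$, the transformation groupoid $X\rtimes G$ is $X\times G$ with the product topology, unit space $X$ (identified with $X\times\{1\}$), $r(x,\gamma)=x$, $s(x,\gamma)=\gamma^{-1}x$, $(x,\gamma)(\gamma^{-1}x,\gamma')=(x,\gamma\gamma')$. The Stein groupoid is $\mathcal{S}(\Gamma,\Lambda):=\mathbb{R}_\Gamma\rtimes(\Gamma\rtimes\Lambda)$. Isomorphism of groupoids means isomorphism of topological (étale) groupoids. *)

theory Defs
  imports "HOL-Analysis.Analysis" "HOL-Algebra.Elementary_Groups"
begin

section \<open>Groups of reals\<close>

definition real_add_group :: "real monoid" where
  "real_add_group = \<lparr>carrier = UNIV, monoid.mult = (+), one = 0\<rparr>"

definition pos_real_group :: "real monoid" where
  "pos_real_group = \<lparr>carrier = {0<..}, monoid.mult = (*), one = 1\<rparr>"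

definition finitely_generated_group :: "('a, 'b) monoid_scheme \<Rightarrow> bool" where
  "finitely_generated_group G \<longleftrightarrow>
     (\<exists>A. finite A \<and> A \<subseteq> carrier G \<and> generate G A = carrier G)"

definition real_module :: "real set \<Rightarrow> real set \<Rightarrow> bool" where
  "real_module \<Lambda> \<Gamma> \<longleftrightarrow> subgroup \<Gamma> real_add_group \<and> (\<forall>l\<in>\<Lambda>. \<forall>t\<in>\<Gamma>. l * t \<in> \<Gamma>)"

lemma group_real_add_group: "group real_add_group"
proof (rule groupI)
  fix x assume "x \<in> carrier real_add_group"
  show "\<exists>y\<in>carrier real_add_group. y \<otimes>\<^bsub>real_add_group\<^esub> x = \<one>\<^bsub>real_add_group\<^esub>"
    by (intro bexI[of _ "- x"]) (auto simp: real_add_group_def)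
qed (auto simp: real_add_group_def)

lemma comm_group_pos_real_group: "comm_group pos_real_group"
proof (rule comm_groupI)
  fix x assume "x \<in> carrier pos_real_group"
  then show "\<exists>y\<in>carrier pos_real_group. y \<otimes>\<^bsub>pos_real_group\<^esub> x = \<one>\<^bsub>pos_real_group\<^esub>"
    by (intro bexI[of _ "inverse x"]) (auto simp: pos_real_group_def)
qed (auto simp: pos_real_group_def)

definition affine_group :: "real set \<Rightarrow> real set \<Rightarrow> (real \<times> real) monoid" where
  "affine_group \<Gamma> \<Lambda> =
     \<lparr>carrier = \<Gamma> \<times> \<Lambda>,
      monoid.mult = (\<lambda>(s, l) (s', l'). (s + l * s', l * l')),
      one = (0, 1)\<rparr>"


section \<open>The line with the points of \<open>\<Gamma>\<close> doubled\<close>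

text \<open>\<open>Pt x\<close> stands for a point \<open>x\<close> outside \<open>\<Gamma>\<close>, and \<open>Minus t\<close>, \<open>Plus t\<close> for the two copies
  of a point \<open>t\<close> of \<open>\<Gamma>\<close>. The type does not depend on \<open>\<Gamma>\<close>; the set \<open>split_line \<Gamma>\<close> does.\<close>

datatype split_point = Pt real | Minus real | Plus real

definition split_line :: "real set \<Rightarrow> split_point set" where
  "split_line \<Gamma> = Pt ` (- \<Gamma>) \<union> Minus ` \<Gamma> \<union> Plus ` \<Gamma>"

fun split_proj :: "split_point \<Rightarrow> real" where
  "split_proj (Pt x) = x"
| "split_proj (Minus t) = t"
| "split_proj (Plus t) = t"

definition split_less :: "split_point \<Rightarrow> split_point \<Rightarrow> bool" where
  "split_less x y \<longleftrightarrow> split_proj x < split_proj y \<or> (\<exists>t. x = Minus t \<and> y = Plus t)"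

definition order_topology_on :: "'a set \<Rightarrow> ('a \<Rightarrow> 'a \<Rightarrow> bool) \<Rightarrow> 'a topology" where
  "order_topology_on X lt =
     topology_generated_by
       ({X} \<union> (\<lambda>a. {x \<in> X. lt a x}) ` X \<union> (\<lambda>a. {x \<in> X. lt x a}) ` X)"

definition split_topology :: "real set \<Rightarrow> split_point topology" where
  "split_topology \<Gamma> = order_topology_on (split_line \<Gamma>) split_less"

lemma topspace_split_topology [simp]: "topspace (split_topology \<Gamma>) = split_line \<Gamma>"
  by (auto simp: split_topology_def order_topology_on_def)

fun affine_act :: "real \<times> real \<Rightarrow> split_point \<Rightarrow> split_point" where
  "affine_act (s, l) (Pt x) = Pt (l * x + s)"
| "affine_act (s, l) (Minus t) = Minus (l * t + s)"
| "affine_act (s, l) (Plus t) = Plus (l * t + s)"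


section \<open>Topological groupoids\<close>

text \<open>A groupoid is given by its space of arrows. Units are identified with identity arrows, so
  range and source are maps from arrows to arrows; the product of \<open>g\<close> and \<open>h\<close> is meaningful only
  if the source of \<open>g\<close> is the range of \<open>h\<close>.\<close>

record 'a top_groupoid =
  arrows :: "'a topology"
  grange :: "'a \<Rightarrow> 'a"
  gsource :: "'a \<Rightarrow> 'a"
  gmult :: "'a \<Rightarrow> 'a \<Rightarrow> 'a"

text \<open>An isomorphism is a functor which is a homeomorphism on arrows. Being a functor between
  groupoids it preserves inverses, and its inverse map is a functor as well.\<close>

definition top_groupoid_iso :: "'a top_groupoid \<Rightarrow> 'b top_groupoid \<Rightarrow> ('a \<Rightarrow> 'b) \<Rightarrow> bool" where
  "top_groupoid_iso G H f \<longleftrightarrow>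
     homeomorphic_map (arrows G) (arrows H) f \<and>
     (\<forall>g\<in>topspace (arrows G).
        f (grange G g) = grange H (f g) \<and> f (gsource G g) = gsource H (f g)) \<and>
     (\<forall>g\<in>topspace (arrows G). \<forall>h\<in>topspace (arrows G).
        gsource G g = grange G h \<longrightarrow> f (gmult G g h) = gmult H (f g) (f h))"

definition isomorphic_top_groupoids :: "'a top_groupoid \<Rightarrow> 'b top_groupoid \<Rightarrow> bool" where
  "isomorphic_top_groupoids G H \<longleftrightarrow> (\<exists>f. top_groupoid_iso G H f)"

definition transformation_groupoid ::
  "'x topology \<Rightarrow> 'g monoid \<Rightarrow> ('g \<Rightarrow> 'x \<Rightarrow> 'x) \<Rightarrow> ('x \<times> 'g) top_groupoid" where
  "transformation_groupoid X G act =
     \<lparr>arrows = prod_topology X (discrete_topology (carrier G)),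
      grange = (\<lambda>(x, \<gamma>). (x, \<one>\<^bsub>G\<^esub>)),
      gsource = (\<lambda>(x, \<gamma>). (act (inv\<^bsub>G\<^esub> \<gamma>) x, \<one>\<^bsub>G\<^esub>)),
      gmult = (\<lambda>(x, \<gamma>) (y, \<gamma>'). (x, \<gamma> \<otimes>\<^bsub>G\<^esub> \<gamma>'))\<rparr>"

definition stein_groupoid ::
  "real set \<Rightarrow> real set \<Rightarrow> (split_point \<times> (real \<times> real)) top_groupoid" where
  "stein_groupoid \<Gamma> \<Lambda> =
     transformation_groupoid (split_topology \<Gamma>) (affine_group \<Gamma> \<Lambda>) affine_act"


section \<open>Well-definedness\<close>

context
  fixes \<Gamma> \<Lambda> :: "real set"
  assumes L: "subgroup \<Lambda> pos_real_group" and M: "real_module \<Lambda> \<Gamma>"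
begin

lemma \<Lambda>_pos: "l \<in> \<Lambda> \<Longrightarrow> l > 0"
  and \<Lambda>_one: "1 \<in> \<Lambda>"
  and \<Lambda>_mult: "l \<in> \<Lambda> \<Longrightarrow> l' \<in> \<Lambda> \<Longrightarrow> l * l' \<in> \<Lambda>"
  using subgroup.subset[OF L] subgroup.one_closed[OF L] subgroup.m_closed[OF L]
  by (auto simp: pos_real_group_def)

lemma \<Lambda>_inverse: assumes "l \<in> \<Lambda>" shows "inverse l \<in> \<Lambda>"
proof -
  interpret comm_group pos_real_group by (rule comm_group_pos_real_group)
  have "inv\<^bsub>pos_real_group\<^esub> l = inverse l"
    using \<Lambda>_pos[OF assms] by (intro inv_equality) (auto simp: pos_real_group_def)
  then show ?thesis using subgroup.m_inv_closed[OF L assms] by simp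
qed

lemma \<Gamma>_zero: "0 \<in> \<Gamma>"
  and \<Gamma>_add: "s \<in> \<Gamma> \<Longrightarrow> t \<in> \<Gamma> \<Longrightarrow> s + t \<in> \<Gamma>"
  and \<Gamma>_scale: "l \<in> \<Lambda> \<Longrightarrow> t \<in> \<Gamma> \<Longrightarrow> l * t \<in> \<Gamma>"
  using M subgroup.one_closed[of \<Gamma> real_add_group] subgroup.m_closed[of \<Gamma> real_add_group]
  by (auto simp: real_module_def real_add_group_def)

lemma \<Gamma>_minus: assumes "t \<in> \<Gamma>" shows "- t \<in> \<Gamma>"
proof -
  interpret group real_add_group by (rule group_real_add_group)
  have "inv\<^bsub>real_add_group\<^esub> t = - t"
    by (intro inv_equality) (auto simp: real_add_group_def)
  then show ?thesis
    using subgroup.m_inv_closed[of \<Gamma> real_add_group t] M assms by (simp add: real_module_def)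
qed

lemma affine_inverse_closed:
  "(s, l) \<in> carrier (affine_group \<Gamma> \<Lambda>) \<Longrightarrow>
   (- (inverse l * s), inverse l) \<in> carrier (affine_group \<Gamma> \<Lambda>)"
  using \<Gamma>_minus \<Gamma>_scale \<Lambda>_inverse by (auto simp: affine_group_def)

lemma group_affine_group: "group (affine_group \<Gamma> \<Lambda>)"
proof (rule groupI)
  fix x assume x: "x \<in> carrier (affine_group \<Gamma> \<Lambda>)"
  obtain s l where sl: "x = (s, l)" by force
  have "l > 0" using x \<Lambda>_pos by (auto simp: sl affine_group_def)
  then show "\<exists>y\<in>carrier (affine_group \<Gamma> \<Lambda>). y \<otimes>\<^bsub>affine_group \<Gamma> \<Lambda>\<^esub> x = \<one>\<^bsub>affine_group \<Gamma> \<Lambda>\<^esub>"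
    using affine_inverse_closed x by (intro bexI[of _ "(- (inverse l * s), inverse l)"])
      (auto simp: sl affine_group_def)
qed (auto simp: affine_group_def \<Gamma>_zero \<Gamma>_add \<Gamma>_scale \<Lambda>_one \<Lambda>_mult algebra_simps)

lemma inv_affine_group:
  assumes "(s, l) \<in> carrier (affine_group \<Gamma> \<Lambda>)"
  shows "inv\<^bsub>affine_group \<Gamma> \<Lambda>\<^esub> (s, l) = (- (inverse l * s), inverse l)"
proof -
  interpret group "affine_group \<Gamma> \<Lambda>" by (rule group_affine_group)
  have "l > 0" using assms \<Lambda>_pos by (auto simp: affine_group_def)
  with assms affine_inverse_closed show ?thesis
    by (intro inv_equality) (auto simp: affine_group_def)
qed

lemma affine_act_closed:
  assumes g: "g \<in> carrier (affine_group \<Gamma> \<Lambda>)" and x: "x \<in> split_line \<Gamma>"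
  shows "affine_act g x \<in> split_line \<Gamma>"
proof -
  obtain s l where sl: "g = (s, l)" "s \<in> \<Gamma>" "l \<in> \<Lambda>" using g by (auto simp: affine_group_def)
  have fwd: "l * t + s \<in> \<Gamma>" if "t \<in> \<Gamma>" for t
    by (intro \<Gamma>_add \<Gamma>_scale that sl)
  have bwd: "u \<in> \<Gamma>" if "l * u + s \<in> \<Gamma>" for u
  proof -
    have "inverse l * ((l * u + s) + - s) = u" using \<Lambda>_pos[OF sl(3)] by simp
    moreover have "inverse l * ((l * u + s) + - s) \<in> \<Gamma>"
      by (intro \<Gamma>_scale \<Gamma>_add \<Gamma>_minus \<Lambda>_inverse that sl)
    ultimately show ?thesis by (simp only:)
  qed
  from x show ?thesis
    unfolding split_line_def sl(1) by (auto intro: fwd dest: bwd)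
qed

end

lemma affine_act_one: "affine_act \<one>\<^bsub>affine_group \<Gamma> \<Lambda>\<^esub> x = x"
  by (cases x) (auto simp: affine_group_def)

lemma affine_act_mult:
  "affine_act (g \<otimes>\<^bsub>affine_group \<Gamma> \<Lambda>\<^esub> h) x = affine_act g (affine_act h x)"
  by (cases g; cases h; cases x) (auto simp: affine_group_def algebra_simps)

end

theory Submission
  imports Defs
begin

text \<open>An isomorphism of topological groupoids embeds the isotropy group of each unit into the
  isotropy group of its image. In the Stein groupoid of \<open>\<Gamma>\<close> and \<open>\<Lambda>\<close> an affine map fixing a point is
  determined by its linear part, so every isotropy group embeds into \<open>\<Lambda>\<close> (\<open>isotropy_stein_mon\<close>). At the unit \<open>Plus 0\<close> the dilations
  \<open>t \<mapsto> l * t\<close> with \<open>l \<in> \<Lambda>\<close> are all present, so \<open>\<Lambda>\<close> embeds into that isotropy group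
  (\<open>isotropy_stein_Plus_zero_mon\<close>). Applied to an isomorphism and to its inverse, this embeds
  \<open>\<Lambda>1\<close> into \<open>\<Lambda>2\<close> and \<open>\<Lambda>2\<close> into \<open>\<Lambda>1\<close> (\<open>stein_iso_imp_mon\<close>).

  What remains is algebra (\<open>finitely_generated_iso_of_mutual_mon\<close>): since \<open>\<Lambda>1\<close> is finitely generated
  and torsion-free, it is free of some finite rank; \<open>\<Lambda>2\<close> is isomorphic to a subgroup of \<open>\<Lambda>1\<close>, hence
  free of at most that rank, and it contains a copy of \<open>\<Lambda>1\<close>, hence it has at least that rank.
  The logarithm turns both groups into additive subgroups of the real line, where this is linear
  algebra: a free generating system is a finite set that is linearly independent over the rational
  numbers and whose integral span is the group. Such a set exists for every
  subgroup of a finitely generated group (\<open>subgroup_of_finitely_generated_has_basis\<close>), and ranks are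
  compared by the dimension theory of the \<open>\<rat>\<close>-vector space of real numbers
  (\<open>card_basis_le_of_injective_additive\<close>).\<close>

section \<open>Integral and rational spans in the real line\<close>

interpretation Z: module "\<lambda>(k::int) (x::real). of_int k * x"
  by unfold_locales (auto simp: algebra_simps)

interpretation Q: vector_space "\<lambda>(q::rat) (x::real). of_rat q * x"
  by unfold_locales (auto simp: algebra_simps of_rat_add of_rat_mult)

interpretation QQ: vector_space_pair "\<lambda>(q::rat) (x::real). of_rat q * x" "\<lambda>(q::rat) (x::real). of_rat q * x"
  by unfold_locales

(* As simplification rules these would form a loop with of_int_mult and of_rat_mult. *)
declare Z.scale_scale [simp del] Q.scale_scale [simp del]

lemma Q_subspace_imp_Z_subspace:
  assumes "Q.subspace S"
  shows "Z.subspace S"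
proof (rule Z.subspaceI)
  show "of_int k * x \<in> S" if "x \<in> S" for k x
    using Q.subspace_scale[OF assms that, of "of_int k"] by simp
qed (use assms in \<open>auto intro: Q.subspace_0 Q.subspace_add\<close>)

lemma Z_span_subset_Q_span: "Z.span S \<subseteq> Q.span S"
  by (intro Z.span_minimal Q.span_superset Q_subspace_imp_Z_subspace) auto

lemma Q_linear_imp_Z_linear:
  assumes "Vector_Spaces.linear (\<lambda>(q::rat) (x::real). of_rat q * x) (\<lambda>(q::rat) (x::real). of_rat q * x) f"
  shows "module_hom (\<lambda>(k::int) (x::real). of_int k * x) (\<lambda>(k::int) (x::real). of_int k * x) f"
proof -
  interpret f: Vector_Spaces.linear "\<lambda>(q::rat) (x::real). of_rat q * x" "\<lambda>(q::rat) (x::real). of_rat q * x" f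
    by (fact assms)
  show ?thesis
  proof unfold_locales
    show "f (of_int k * x) = of_int k * f x" for k x
      using f.scale[of "of_int k" x] by simp
  qed (rule f.add)
qed

lemma multiplication_Q_linear:
  "Vector_Spaces.linear (\<lambda>(q::rat) (x::real). of_rat q * x) (\<lambda>(q::rat) (x::real). of_rat q * x) ((*) c)"
  by unfold_locales (auto simp: algebra_simps)

lemma Q_span_multiple_in_Z_span:
  assumes "x \<in> Q.span S"
  shows "\<exists>n::int. n > 0 \<and> of_int n * x \<in> Z.span S"
  using assms
proof (induction rule: Q.span_induct_alt)
  case base
  show ?case by (auto intro: exI[of _ 1] Z.span_zero)
next
  case (step c x y)
  then obtain n where n: "n > 0" "of_int n * y \<in> Z.span S" by auto
  obtain a b where ab: "quotient_of c = (a, b)" by force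
  then have b: "b > 0" "c = of_int a / of_int b"
    by (auto simp: quotient_of_denom_pos quotient_of_div)
  have "of_int (b * n) * (of_rat c * x + y) = of_int (n * a) * x + of_int b * (of_int n * y)"
  proof -
    have bc: "of_int b * of_rat c = (of_int a :: real)"
      using b by (simp add: of_rat_divide)
    have "of_int (b * n) * (of_rat c * x + y) =
        of_int n * (of_int b * of_rat c) * x + of_int b * (of_int n * y)"
      by (simp add: algebra_simps)
    then show ?thesis by (simp only: bc of_int_mult)
  qed
  moreover have "\<dots> \<in> Z.span S"
    by (intro Z.span_add Z.span_scale Z.span_base step n)
  ultimately have "of_int (b * n) * (of_rat c * x + y) \<in> Z.span S" by (simp only:)
  with b n show ?case by (intro exI[of _ "b * n"]) auto
qed

lemma finite_Q_span_multiple_in_Z_span: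
  assumes "finite F" and "F \<subseteq> Q.span S"
  shows "\<exists>n::int. n > 0 \<and> (\<forall>x\<in>F. of_int n * x \<in> Z.span S)"
  using assms
proof (induction F)
  case empty
  show ?case by (auto intro: exI[of _ 1])
next
  case (insert x F)
  then obtain n where n: "n > 0" "\<forall>x\<in>F. of_int n * x \<in> Z.span S" by auto
  obtain m where m: "m > 0" "of_int m * x \<in> Z.span S"
    using Q_span_multiple_in_Z_span[of x S] insert by auto
  have "of_int (m * n) * y \<in> Z.span S" if "y \<in> insert x F" for y
  proof (cases "y = x")
    case True
    then show ?thesis using Z.span_scale[OF m(2), of n] by (simp add: ac_simps)
  next
    case False
    then show ?thesis using Z.span_scale[of "of_int n * y" S m] n that by (simp add: ac_simps)
  qed
  with m n show ?case by (intro exI[of _ "m * n"]) auto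
qed

text \<open>The induction removes one basis vector \<open>t\<close>. The coefficients at \<open>t\<close> of the elements of
  \<open>A\<close> form a subgroup \<open>d\<int>\<close> of the integers, so that an element \<open>a\<close> with coefficient \<open>d\<close>
  generates \<open>A\<close> together with the elements of \<open>A\<close> that do not involve \<open>t\<close>. If \<open>d \<noteq> 0\<close>, then \<open>a\<close> is
  independent of those elements, because \<open>t\<close> is not in the rational span of the others.\<close>

lemma subgroup_of_free_has_basis:
  assumes "finite T" and "Q.independent T" and "Z.subspace A" and "A \<subseteq> Z.span T"
  shows "\<exists>B. finite B \<and> Q.independent B \<and> Z.span B = A"
  using assms
proof (induction T arbitrary: A)
  case empty
  then have "A = {0}" using Z.subspace_0 by auto
  then show ?case by (intro exI[of _ "{}"]) (simp add: Q.independent_empty)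
next
  case (insert t T)
  have t: "t \<notin> Q.span T" and T: "Q.independent T"
    using insert.prems(1) insert.hyps(2) by (auto simp: Q.independent_insert)
  define K where "K = {k::int. \<exists>x\<in>A. x - of_int k * t \<in> Z.span T}"
  have A_coeff: "\<exists>k\<in>K. x - of_int k * t \<in> Z.span T" if x: "x \<in> A" for x
  proof -
    have "x \<in> Z.span (insert t T)" using x insert.prems(3) by blast
    then obtain k where "x - of_int k * t \<in> Z.span T"
      by (auto simp: Z.span_breakdown_eq)
    then show ?thesis using x by (auto simp: K_def)
  qed
  show ?case
  proof (cases "K \<subseteq> {0}")
    case True
    have "A \<subseteq> Z.span T" using A_coeff True by force
    then show ?thesis using insert.IH T insert.prems(2) by blast
  next
    case False
    have K_comb: "k - c * l \<in> K" if "k \<in> K" "l \<in> K" for k l c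
    proof -
      obtain x y where xy: "x \<in> A" "y \<in> A" "x - of_int k * t \<in> Z.span T" "y - of_int l * t \<in> Z.span T"
        using \<open>k \<in> K\<close> \<open>l \<in> K\<close> by (auto simp: K_def)
      have "(x - of_int k * t) - of_int c * (y - of_int l * t) \<in> Z.span T"
        by (intro Z.span_diff Z.span_scale xy)
      moreover have "(x - of_int k * t) - of_int c * (y - of_int l * t) =
          (x - of_int c * y) - of_int (k - c * l) * t"
        by (simp add: algebra_simps)
      moreover have "x - of_int c * y \<in> A"
        by (intro Z.subspace_diff Z.subspace_scale insert.prems(2) xy)
      ultimately show ?thesis unfolding K_def by auto
    qed
    obtain k where k: "k \<in> K" "k \<noteq> 0" using False by auto
    (* K is closed under negation, so it has a positive element; the least one generates K. *)
    have "\<exists>n::nat. n > 0 \<and> int n \<in> K"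
    proof (cases "k > 0")
      case True
      with k show ?thesis by (intro exI[of _ "nat k"]) auto
    next
      case False
      with k K_comb[OF k(1) k(1), of 2] show ?thesis by (intro exI[of _ "nat (- k)"]) auto
    qed
    then obtain n where n: "n > 0" "int n \<in> K" and n_min: "\<And>m. m > 0 \<Longrightarrow> int m \<in> K \<Longrightarrow> n \<le> m"
      using exists_least_iff[of "\<lambda>n. n > 0 \<and> int n \<in> K"] by (metis not_less)
    have n_dvd: "int n dvd k" if "k \<in> K" for k
    proof -
      have "k mod int n \<in> K"
        using K_comb[OF that n(2), of "k div int n"] by (simp add: minus_div_mult_eq_mod)
      moreover have "0 \<le> k mod int n" and less: "k mod int n < int n" using n(1) by auto
      ultimately obtain m where m: "k mod int n = int m" "int m \<in> K"
        using nonneg_int_cases by metis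
      with less n_min[of m] have "k mod int n = 0" by (cases "m = 0") auto
      then show ?thesis by auto
    qed
    obtain a where a: "a \<in> A" "a - real n * t \<in> Z.span T" using n(2) by (auto simp: K_def)
    obtain C where C: "finite C" "Q.independent C" "Z.span C = A \<inter> Z.span T"
      using insert.IH[OF T, of "A \<inter> Z.span T"] insert.prems(2) Z.subspace_inter by auto
    have "a \<notin> Q.span C"
    proof
      assume "a \<in> Q.span C"
      moreover have "Q.span C \<subseteq> Q.span T"
        using C(3) Z.span_superset[of C] Z_span_subset_Q_span[of T] by (intro Q.span_minimal) auto
      moreover have "a - real n * t \<in> Q.span T" using a(2) Z_span_subset_Q_span by blast
      ultimately have "a - (a - real n * t) \<in> Q.span T" by (blast intro: Q.span_diff)
      then have "real n * t \<in> Q.span T" by simp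
      then have "of_rat (1 / of_nat n) * (real n * t) \<in> Q.span T"
        by (rule Q.span_scale)
      with t n(1) show False by (simp add: of_rat_divide)
    qed
    then have "Q.independent (insert a C)" using C(2) by (rule Q.independent_insertI)
    moreover have "Z.span (insert a C) = A"
    proof
      show "Z.span (insert a C) \<subseteq> A"
        using a(1) C(3) Z.span_superset[of C] insert.prems(2) by (intro Z.span_minimal) auto
      show "A \<subseteq> Z.span (insert a C)"
      proof
        fix x assume x: "x \<in> A"
        then obtain k where k: "k \<in> K" "x - of_int k * t \<in> Z.span T" using A_coeff by auto
        obtain q where q: "k = int n * q" using n_dvd[OF k(1)] by auto
        have "(x - of_int k * t) - of_int q * (a - real n * t) \<in> Z.span T"
          by (intro Z.span_diff Z.span_scale k a)
        also have "(x - of_int k * t) - of_int q * (a - real n * t) = x - of_int q * a"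
          by (simp add: q algebra_simps)
        finally have "x - of_int q * a \<in> Z.span C"
          using C(3) x a(1) insert.prems(2) by (auto intro!: Z.subspace_diff Z.subspace_scale)
        then show "x \<in> Z.span (insert a C)" by (auto simp: Z.span_breakdown_eq)
      qed
    qed
    ultimately show ?thesis using C(1) by (intro exI[of _ "insert a C"]) auto
  qed
qed

text \<open>The given generators may be dependent. Multiplying by a common denominator moves \<open>A\<close> into
  the integral span of a maximal independent subset of them, and dividing moves a basis back.\<close>

lemma subgroup_of_finitely_generated_has_basis:
  assumes "finite S" and "Z.subspace A" and "A \<subseteq> Z.span S"
  shows "\<exists>B. finite B \<and> Q.independent B \<and> Z.span B = A"
proof -
  obtain T where T: "T \<subseteq> S" "Q.independent T" "S \<subseteq> Q.span T"
    using Q.maximal_independent_subset .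
  obtain n :: int where n: "n > 0" "\<forall>x\<in>S. of_int n * x \<in> Z.span T"
    using finite_Q_span_multiple_in_Z_span[OF assms(1) T(3)] by auto
  define c :: real where "c = of_int n"
  have c: "c \<noteq> 0" using n by (simp add: c_def)
  interpret c: module_hom "\<lambda>(k::int) (x::real). of_int k * x" "\<lambda>(k::int) (x::real). of_int k * x" "(*) c"
    by (intro Q_linear_imp_Z_linear multiplication_Q_linear)
  interpret d: module_hom "\<lambda>(k::int) (x::real). of_int k * x" "\<lambda>(k::int) (x::real). of_int k * x" "(*) (1 / c)"
    by (intro Q_linear_imp_Z_linear multiplication_Q_linear)
  interpret d': Vector_Spaces.linear "\<lambda>(q::rat) (x::real). of_rat q * x" "\<lambda>(q::rat) (x::real). of_rat q * x" "(*) (1 / c)"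
    by (rule multiplication_Q_linear)
  have "(*) c ` A \<subseteq> (*) c ` Z.span S" using assms(3) by auto
  also have "\<dots> = Z.span ((*) c ` S)" by (rule c.span_image[symmetric])
  also have "\<dots> \<subseteq> Z.span T" using n(2) by (intro Z.span_minimal) (auto simp: c_def)
  finally obtain C where C: "finite C" "Q.independent C" "Z.span C = (*) c ` A"
    using subgroup_of_free_has_basis[OF finite_subset[OF T(1) assms(1)] T(2) c.subspace_image[OF assms(2)]]
    by auto
  have "Z.span ((*) (1 / c) ` C) = (*) (1 / c) ` (*) c ` A"
    using C(3) by (simp only: d.span_image)
  also have "\<dots> = A" using c by (simp add: image_comp comp_def)
  finally have "Z.span ((*) (1 / c) ` C) = A" .
  moreover have "Q.independent ((*) (1 / c) ` C)"
    using C(2) c by (intro d'.independent_injective_image) (auto simp: inj_on_def)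
  ultimately show ?thesis using C(1) by blast
qed


section \<open>Additive groups of real numbers\<close>

lemma real_subgroup_imp_Z_subspace:
  assumes "subgroup L real_add_group"
  shows "Z.subspace L"
proof -
  have zero: "0 \<in> L" using subgroup.one_closed[OF assms] by (simp add: real_add_group_def)
  have add: "x + y \<in> L" if "x \<in> L" "y \<in> L" for x y
    using subgroup.m_closed[OF assms that] by (simp add: real_add_group_def)
  interpret group real_add_group by (rule group_real_add_group)
  have neg: "- x \<in> L" if "x \<in> L" for x
  proof -
    have "inv\<^bsub>real_add_group\<^esub> x = - x"
      by (intro inv_equality) (auto simp: real_add_group_def)
    then show ?thesis using subgroup.m_inv_closed[OF assms that] by simp
  qed
  show ?thesis
  proof (rule Z.subspaceI)
    show "of_int k * x \<in> L" if x: "x \<in> L" for k x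
    proof (induction k rule: int_induct[where k = 0])
      case (step1 i)
      then show ?case using add[OF step1(2) x] by (simp add: algebra_simps)
    next
      case (step2 i)
      then show ?case using add[OF step2(2) neg[OF x]] by (simp add: algebra_simps)
    qed (simp add: zero)
  qed (auto intro: zero add)
qed

lemma additive_on_int_multiple:
  assumes L: "Z.subspace L" and h: "\<And>x y. x \<in> L \<Longrightarrow> y \<in> L \<Longrightarrow> h (x + y) = h x + (h y :: real)"
    and x: "x \<in> L"
  shows "h (of_int k * x) = of_int k * h x"
proof (induction k rule: int_induct[where k = 0])
  case base
  show ?case using h[of 0 0] Z.subspace_0[OF L] by simp
next
  case (step1 i)
  then show ?case using h[OF Z.subspace_scale[OF L x, of i] x] by (simp add: algebra_simps)
next
  case (step2 i)
  then show ?case using h[OF Z.subspace_scale[OF L x, of "i - 1"] x] by (simp add: algebra_simps)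
qed

text \<open>An injective additive map on \<open>Z.span B\<close> extends to a \<open>\<rat>\<close>-linear map that is still injective on
  \<open>Q.span B\<close>, because every element there has a non-zero multiple in \<open>Z.span B\<close>. So the rank
  cannot drop.\<close>

lemma card_basis_le_of_injective_additive:
  assumes "Q.independent B" and C: "finite C"
    and h: "\<And>x y. x \<in> Z.span B \<Longrightarrow> y \<in> Z.span B \<Longrightarrow> h (x + y) = h x + h y"
    and inj: "inj_on h (Z.span B)" and sub: "h ` Z.span B \<subseteq> Z.span C"
  shows "card B \<le> card C"
proof -
  obtain F where F: "Vector_Spaces.linear (\<lambda>(q::rat) (x::real). of_rat q * x) (\<lambda>(q::rat) (x::real). of_rat q * x) F"
      and FB: "\<forall>b\<in>B. F b = h b"
    using QQ.linear_independent_extend[OF assms(1), of h] by auto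
  interpret F: Vector_Spaces.linear "\<lambda>(q::rat) (x::real). of_rat q * x" "\<lambda>(q::rat) (x::real). of_rat q * x" F
    by (fact F)
  interpret FZ: module_hom "\<lambda>(k::int) (x::real). of_int k * x" "\<lambda>(k::int) (x::real). of_int k * x" F
    by (rule Q_linear_imp_Z_linear[OF F])
  have h0: "h 0 = 0" using h[of 0 0] Z.span_zero by simp
  have Fh: "x \<in> Z.span B \<and> F x = h x" if "x \<in> Z.span B" for x
    using that
  proof (induction rule: Z.span_induct_alt)
    case base
    show ?case by (simp add: h0 Z.span_zero)
  next
    case (step c x y)
    have x: "x \<in> Z.span B" by (intro Z.span_base step)
    have y: "y \<in> Z.span B" "F y = h y" using step.IH by auto
    have cx: "of_int c * x \<in> Z.span B" using x by (rule Z.span_scale)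
    have "h (of_int c * x) = of_int c * h x"
      using Z.subspace_span h x by (rule additive_on_int_multiple)
    then have "F (of_int c * x + y) = h (of_int c * x + y)"
      using h[OF cx y(1)] y(2) FB step.hyps FZ.scale[of c x] by (simp add: FZ.add)
    then show ?case using Z.span_add[OF cx y(1)] by blast
  qed
  have "inj_on F (Q.span B)"
    unfolding F.inj_on_iff_eq_0[OF Q.subspace_span]
  proof (intro ballI impI)
    fix x assume x: "x \<in> Q.span B" "F x = 0"
    obtain n :: int where n: "n > 0" "of_int n * x \<in> Z.span B"
      using Q_span_multiple_in_Z_span[OF x(1)] by auto
    have "h (of_int n * x) = h 0"
      using Fh[OF n(2)] FZ.scale[of n x] x(2) h0 by simp
    with inj n have "of_int n * x = 0" by (auto dest: inj_onD intro: Z.span_zero)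
    with n(1) show "x = 0" by simp
  qed
  then have indep: "Q.independent (F ` B)" by (intro F.independent_injective_image assms(1))
  have "F ` B \<subseteq> Q.span C"
  proof (rule image_subsetI)
    fix b assume "b \<in> B"
    then show "F b \<in> Q.span C"
      using FB sub Z.span_base[of b B] Z_span_subset_Q_span[of C] by auto
  qed
  from Q.independent_span_bound[OF C indep this] have "card (F ` B) \<le> card C" by simp
  moreover have "inj_on F B"
    using \<open>inj_on F (Q.span B)\<close> Q.span_superset by (rule inj_on_subset)
  ultimately show ?thesis by (simp add: card_image)
qed

text \<open>Both groups have finite bases. The inclusion of \<open>A\<close> into \<open>L\<close> and the embedding \<open>h\<close> of \<open>L\<close> into \<open>A\<close>
  force these to have the same cardinality, and a bijection between them extends linearly to an
  isomorphism.\<close>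

lemma subgroup_of_finitely_generated_iso_of_mon:
  assumes S: "finite S" and L: "Z.span S = L" and A: "Z.subspace A" "A \<subseteq> L"
    and h: "h \<in> mon (real_add_group\<lparr>carrier := L\<rparr>) (real_add_group\<lparr>carrier := A\<rparr>)"
  shows "real_add_group\<lparr>carrier := L\<rparr> \<cong> real_add_group\<lparr>carrier := A\<rparr>"
proof -
  obtain B where B: "finite B" "Q.independent B" "Z.span B = L"
    using subgroup_of_finitely_generated_has_basis[OF S, of L] L by auto
  obtain C where C: "finite C" "Q.independent C" "Z.span C = A"
    using subgroup_of_finitely_generated_has_basis[OF S A(1)] A L by auto
  have "card B \<le> card C"
  proof (rule card_basis_le_of_injective_additive[OF B(2) C(1)])
    show "h (x + y) = h x + h y" if "x \<in> Z.span B" "y \<in> Z.span B" for x y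
      using that h B(3) by (auto simp: mon_def hom_def real_add_group_def)
  qed (use h B C in \<open>auto simp: mon_def hom_def\<close>)
  moreover have "card C \<le> card B"
    by (rule card_basis_le_of_injective_additive[OF C(2) B(1), of "\<lambda>x. x"]) (use A B C in auto)
  ultimately have card: "card B = card C" by simp
  note dim = Q.dim_span_eq_card_independent[OF B(2)] Q.dim_span_eq_card_independent[OF C(2)]
  obtain f where f: "Vector_Spaces.linear (\<lambda>(q::rat) (x::real). of_rat q * x) (\<lambda>(q::rat) (x::real). of_rat q * x) f"
      and fB: "f ` B = C" and inj: "inj_on f (Q.span B)"
    using QQ.finite_basis_to_basis_subspace_isomorphism
      [OF Q.subspace_span[of B] Q.subspace_span[of C] _ B(1) Q.span_superset B(2) subset_refl _
        C(1) Q.span_superset C(2) subset_refl]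
      card dim by metis
  interpret f: module_hom "\<lambda>(k::int) (x::real). of_int k * x" "\<lambda>(k::int) (x::real). of_int k * x" f
    by (rule Q_linear_imp_Z_linear[OF f])
  have "f ` L = A" using f.span_image[of B] fB B C by simp
  moreover have "inj_on f L" using inj_on_subset[OF inj Z_span_subset_Q_span] B by simp
  ultimately have "f \<in> iso (real_add_group\<lparr>carrier := L\<rparr>) (real_add_group\<lparr>carrier := A\<rparr>)"
    by (auto simp: iso_def hom_def bij_betw_def real_add_group_def f.add)
  then show ?thesis by (rule is_isoI)
qed

lemma group_real_subgroup: "subgroup H real_add_group \<Longrightarrow> group (real_add_group\<lparr>carrier := H\<rparr>)"
  using group.subgroup_imp_group[OF group_real_add_group] .

lemma group_pos_real_subgroup: "subgroup H pos_real_group \<Longrightarrow> group (pos_real_group\<lparr>carrier := H\<rparr>)"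
  using group.subgroup_imp_group[OF comm_group.axioms(2)[OF comm_group_pos_real_group]] .

lemma ln_iso_pos_real_subgroup:
  assumes "subgroup H pos_real_group"
  shows "ln \<in> iso (pos_real_group\<lparr>carrier := H\<rparr>) (real_add_group\<lparr>carrier := ln ` H\<rparr>)"
proof -
  have "H \<subseteq> {0<..}" using subgroup.subset[OF assms] by (simp add: pos_real_group_def)
  then show ?thesis
    by (auto simp: iso_def hom_def bij_betw_def inj_on_def pos_real_group_def real_add_group_def
        ln_mult subset_iff)
qed

lemma ln_iso_pos_real_group: "ln \<in> iso pos_real_group real_add_group"
proof -
  have "x \<in> ln ` {0<..}" for x :: real by (rule image_eqI[of _ _ "exp x"]) auto
  then show ?thesis
    by (auto simp: iso_def hom_def bij_betw_def inj_on_def pos_real_group_def real_add_group_def ln_mult)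
qed

lemma subgroup_ln_image:
  assumes "subgroup H pos_real_group"
  shows "subgroup (ln ` H) real_add_group"
proof -
  have "group_hom pos_real_group real_add_group ln"
    using ln_iso_pos_real_group comm_group.axioms(2)[OF comm_group_pos_real_group] group_real_add_group
    by (auto simp: group_hom_def group_hom_axioms_def iso_def)
  then show ?thesis using assms by (rule group_hom.subgroup_img_is_subgroup)
qed

lemma finitely_generated_ln_image:
  assumes H: "subgroup H pos_real_group"
    and "finitely_generated_group (pos_real_group\<lparr>carrier := H\<rparr>)"
  shows "\<exists>S. finite S \<and> Z.span S = ln ` H"
proof -
  obtain S where S: "finite S" "S \<subseteq> H" "generate (pos_real_group\<lparr>carrier := H\<rparr>) S = H"
    using assms(2) by (auto simp: finitely_generated_group_def)
  have pos: "x > 0" if "x \<in> H" for x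
    using subgroup.subset[OF H] that by (auto simp: pos_real_group_def)
  interpret comm_group pos_real_group by (rule comm_group_pos_real_group)
  have inv_eq: "inv\<^bsub>pos_real_group\<lparr>carrier := H\<rparr>\<^esub> x = inverse x" if "x \<in> H" for x
  proof -
    have "inv\<^bsub>pos_real_group\<lparr>carrier := H\<rparr>\<^esub> x = inv\<^bsub>pos_real_group\<^esub> x"
      using H that by (rule m_inv_consistent)
    also have "\<dots> = inverse x"
      using pos[OF that] by (intro inv_equality) (auto simp: pos_real_group_def)
    finally show ?thesis .
  qed
  have "x \<in> H \<and> ln x \<in> Z.span (ln ` S)" if "x \<in> generate (pos_real_group\<lparr>carrier := H\<rparr>) S" for x
    using that
  proof induction
    case one
    show ?case using subgroup.one_closed[OF H] by (simp add: pos_real_group_def Z.span_zero)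
  next
    case (incl h)
    then show ?case using S by (auto intro: Z.span_base)
  next
    case (inv h)
    have "h \<in> H" using inv S by auto
    then have "inverse h \<in> H"
      using generate.inv[OF inv, of "pos_real_group\<lparr>carrier := H\<rparr>"] by (simp add: S(3) inv_eq)
    moreover have "ln (inverse h) = - ln h" using pos \<open>h \<in> H\<close> by (simp add: ln_inverse)
    ultimately show ?case using inv_eq[OF \<open>h \<in> H\<close>] inv by (auto intro: Z.span_neg Z.span_base)
  next
    case (eng h1 h2)
    then show ?case using subgroup.m_closed[OF H, of h1 h2] pos
      by (auto simp: pos_real_group_def ln_mult intro: Z.span_add)
  qed
  then have "ln ` H \<subseteq> Z.span (ln ` S)" using S(3) by auto
  moreover have "Z.span (ln ` S) \<subseteq> ln ` H"
    using S(2) real_subgroup_imp_Z_subspace[OF subgroup_ln_image[OF H]]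
    by (intro Z.span_minimal) auto
  ultimately show ?thesis using S(1) by blast
qed

text \<open>The group \<open>K\<close> is replaced by its isomorphic image \<open>g ` K\<close> in \<open>H\<close>, into which \<open>H\<close> embeds by
  \<open>g \<circ> f\<close>; logarithms then reduce the claim to additive groups.\<close>

lemma finitely_generated_iso_of_mutual_mon:
  assumes H: "subgroup H pos_real_group" and K: "subgroup K pos_real_group"
    and fg: "finitely_generated_group (pos_real_group\<lparr>carrier := H\<rparr>)"
    and f: "f \<in> mon (pos_real_group\<lparr>carrier := H\<rparr>) (pos_real_group\<lparr>carrier := K\<rparr>)"
    and g: "g \<in> mon (pos_real_group\<lparr>carrier := K\<rparr>) (pos_real_group\<lparr>carrier := H\<rparr>)"
  shows "pos_real_group\<lparr>carrier := H\<rparr> \<cong> pos_real_group\<lparr>carrier := K\<rparr>"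
proof -
  interpret HK: group_hom "pos_real_group\<lparr>carrier := K\<rparr>" "pos_real_group\<lparr>carrier := H\<rparr>" g
    using g group_pos_real_subgroup[OF H] group_pos_real_subgroup[OF K]
    by (auto simp: group_hom_def group_hom_axioms_def mon_def)
  have gK: "subgroup (g ` K) pos_real_group"
    using HK.img_is_subgroup
    by (simp add: group.incl_subgroup[OF comm_group.axioms(2)[OF comm_group_pos_real_group] H])
  have gK_sub: "g ` K \<subseteq> H" using g by (auto simp: mon_def hom_def)
  have g_iso: "g \<in> iso (pos_real_group\<lparr>carrier := K\<rparr>) (pos_real_group\<lparr>carrier := g ` K\<rparr>)"
    using g by (auto simp: iso_def mon_def hom_def bij_betw_def)
  have lnH: "ln \<in> iso (pos_real_group\<lparr>carrier := H\<rparr>) (real_add_group\<lparr>carrier := ln ` H\<rparr>)"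
    using H by (rule ln_iso_pos_real_subgroup)
  have lngK: "ln \<in> iso (pos_real_group\<lparr>carrier := g ` K\<rparr>) (real_add_group\<lparr>carrier := ln ` g ` K\<rparr>)"
    using gK by (rule ln_iso_pos_real_subgroup)
  have exp: "inv_into H ln \<in> iso (real_add_group\<lparr>carrier := ln ` H\<rparr>) (pos_real_group\<lparr>carrier := H\<rparr>)"
    using group.iso_set_sym[OF group_pos_real_subgroup[OF H] lnH] by simp
  have "ln \<circ> (g \<circ> (f \<circ> inv_into H ln)) \<in>
      mon (real_add_group\<lparr>carrier := ln ` H\<rparr>) (real_add_group\<lparr>carrier := ln ` g ` K\<rparr>)"
    using exp f g_iso lngK unfolding iso_iff_mon_epi by (elim conjE) (intro mon_compose)
  moreover obtain S where "finite S" "Z.span S = ln ` H"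
    using finitely_generated_ln_image[OF H fg] by auto
  ultimately have "real_add_group\<lparr>carrier := ln ` H\<rparr> \<cong> real_add_group\<lparr>carrier := ln ` g ` K\<rparr>"
    using image_mono[OF gK_sub, of ln] real_subgroup_imp_Z_subspace[OF subgroup_ln_image[OF gK]]
    by (intro subgroup_of_finitely_generated_iso_of_mon)
  with is_isoI[OF lnH]
  have "pos_real_group\<lparr>carrier := H\<rparr> \<cong> real_add_group\<lparr>carrier := ln ` g ` K\<rparr>"
    by (rule iso_trans)
  also have "real_add_group\<lparr>carrier := ln ` g ` K\<rparr> \<cong> pos_real_group\<lparr>carrier := g ` K\<rparr>"
    using is_isoI[OF lngK] by (rule group.iso_sym[OF group_pos_real_subgroup[OF gK]])
  also have "pos_real_group\<lparr>carrier := g ` K\<rparr> \<cong> pos_real_group\<lparr>carrier := K\<rparr>"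
    using is_isoI[OF g_iso] by (rule group.iso_sym[OF group_pos_real_subgroup[OF K]])
  finally show ?thesis .
qed


section \<open>Isotropy groups\<close>

definition isotropy :: "'a top_groupoid \<Rightarrow> 'a \<Rightarrow> 'a monoid" where
  "isotropy G u =
     \<lparr>carrier = {g \<in> topspace (arrows G). grange G g = u \<and> gsource G g = u},
      monoid.mult = gmult G, one = u\<rparr>"

lemma top_groupoid_iso_isotropy_mon:
  assumes "top_groupoid_iso G H f"
  shows "f \<in> mon (isotropy G u) (isotropy H (f u))"
proof -
  have homeo: "homeomorphic_map (arrows G) (arrows H) f"
    and rs: "\<And>g. g \<in> topspace (arrows G) \<Longrightarrow>
        grange H (f g) = f (grange G g) \<and> gsource H (f g) = f (gsource G g)"
    and mult: "\<And>g h. g \<in> topspace (arrows G) \<Longrightarrow> h \<in> topspace (arrows G) \<Longrightarrow>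
        gsource G g = grange G h \<Longrightarrow> f (gmult G g h) = gmult H (f g) (f h)"
    using assms by (auto simp: top_groupoid_iso_def)
  have inj: "inj_on f (topspace (arrows G))" and img: "f ` topspace (arrows G) = topspace (arrows H)"
    using homeo homeomorphic_imp_injective_map homeomorphic_imp_surjective_map by blast+
  have "inj_on f (carrier (isotropy G u))"
    using inj by (rule inj_on_subset) (auto simp: isotropy_def)
  then show ?thesis
    using img by (auto simp: mon_def hom_def isotropy_def rs mult)
qed

text \<open>The closure hypotheses, which the record \<open>top_groupoid\<close> does not impose, keep the operations of
  \<open>G\<close> inside the space of arrows, where \<open>f\<close> is injective; so the inverse homeomorphism is a functor.\<close>

lemma top_groupoid_iso_inverse:
  assumes f: "top_groupoid_iso G H f"
    and closed: "\<And>g. g \<in> topspace (arrows G) \<Longrightarrow>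
      grange G g \<in> topspace (arrows G) \<and> gsource G g \<in> topspace (arrows G)"
    and mult_closed: "\<And>g h. g \<in> topspace (arrows G) \<Longrightarrow> h \<in> topspace (arrows G) \<Longrightarrow>
      gsource G g = grange G h \<Longrightarrow> gmult G g h \<in> topspace (arrows G)"
  shows "\<exists>f'. top_groupoid_iso H G f'"
proof -
  have homeo: "homeomorphic_map (arrows G) (arrows H) f"
    and rs: "\<And>g. g \<in> topspace (arrows G) \<Longrightarrow>
        grange H (f g) = f (grange G g) \<and> gsource H (f g) = f (gsource G g)"
    and mult: "\<And>g h. g \<in> topspace (arrows G) \<Longrightarrow> h \<in> topspace (arrows G) \<Longrightarrow>
        gsource G g = grange G h \<Longrightarrow> gmult H (f g) (f h) = f (gmult G g h)"
    using f by (auto simp: top_groupoid_iso_def)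
  obtain f' where maps: "homeomorphic_maps (arrows G) (arrows H) f f'"
    using homeo by (auto simp: homeomorphic_map_maps)
  have f'_map: "homeomorphic_map (arrows H) (arrows G) f'"
    using maps homeomorphic_maps_map by blast
  have f'f: "f' (f g) = g" if "g \<in> topspace (arrows G)" for g
    using maps that by (simp add: homeomorphic_maps_def)
  have img: "topspace (arrows H) = f ` topspace (arrows G)"
    using homeomorphic_imp_surjective_map[OF homeo] by simp
  have composable: "gsource G g = grange G h"
    if "g \<in> topspace (arrows G)" "h \<in> topspace (arrows G)" "f (gsource G g) = f (grange G h)" for g h
    using that closed f'f by metis
  have mult': "f' (gmult H (f g) (f h)) = gmult G g h"
    if "g \<in> topspace (arrows G)" "h \<in> topspace (arrows G)" "f (gsource G g) = f (grange G h)" for g h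
    using mult[OF that(1,2) composable[OF that]] mult_closed[OF that(1,2) composable[OF that]]
    by (simp add: f'f)
  have "top_groupoid_iso H G f'"
    unfolding top_groupoid_iso_def img using f'_map closed
    by (simp add: rs f'f mult')
  then show ?thesis by blast
qed

lemma topspace_arrows_stein: "topspace (arrows (stein_groupoid \<Gamma> \<Lambda>)) = split_line \<Gamma> \<times> (\<Gamma> \<times> \<Lambda>)"
  by (simp add: stein_groupoid_def transformation_groupoid_def affine_group_def)

lemma grange_stein: "grange (stein_groupoid \<Gamma> \<Lambda>) (x, \<gamma>) = (x, (0, 1))"
  by (simp add: stein_groupoid_def transformation_groupoid_def affine_group_def)

context
  fixes \<Gamma> \<Lambda> :: "real set"
  assumes L: "subgroup \<Lambda> pos_real_group" and M: "real_module \<Lambda> \<Gamma>"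
begin

lemma gsource_stein:
  assumes "s \<in> \<Gamma>" and "l \<in> \<Lambda>"
  shows "gsource (stein_groupoid \<Gamma> \<Lambda>) (x, (s, l)) =
    (affine_act (- (inverse l * s), inverse l) x, (0, 1))"
proof -
  have "inv\<^bsub>affine_group \<Gamma> \<Lambda>\<^esub> (s, l) = (- (inverse l * s), inverse l)"
    by (rule inv_affine_group[OF L M]) (use assms in \<open>simp add: affine_group_def\<close>)
  then show ?thesis
    by (simp add: stein_groupoid_def transformation_groupoid_def) (simp add: affine_group_def)
qed

lemma stein_range_source_closed:
  assumes "g \<in> topspace (arrows (stein_groupoid \<Gamma> \<Lambda>))"
  shows "grange (stein_groupoid \<Gamma> \<Lambda>) g \<in> topspace (arrows (stein_groupoid \<Gamma> \<Lambda>)) \<and>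
    gsource (stein_groupoid \<Gamma> \<Lambda>) g \<in> topspace (arrows (stein_groupoid \<Gamma> \<Lambda>))"
proof -
  obtain x s l where g: "g = (x, (s, l))" "x \<in> split_line \<Gamma>" "s \<in> \<Gamma>" "l \<in> \<Lambda>"
    using assms by (auto simp: topspace_arrows_stein)
  have "(- (inverse l * s), inverse l) \<in> carrier (affine_group \<Gamma> \<Lambda>)"
    by (rule affine_inverse_closed[OF L M]) (use g in \<open>simp add: affine_group_def\<close>)
  then have "affine_act (- (inverse l * s), inverse l) x \<in> split_line \<Gamma>"
    using g(2) by (rule affine_act_closed[OF L M])
  then show ?thesis
    using g \<Gamma>_zero[OF L M] \<Lambda>_one[OF L M] by (simp add: grange_stein gsource_stein topspace_arrows_stein)
qed

text \<open>If \<open>x\<close> is fixed by \<open>t \<mapsto> l * t + s\<close>, then \<open>s = (1 - l) * split_proj x\<close>, so the linear part \<open>l\<close>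
  determines the isotropy element.\<close>

lemma isotropy_stein_mon:
  "(\<lambda>(x, s, l). l) \<in> mon (isotropy (stein_groupoid \<Gamma> \<Lambda>) u) (pos_real_group\<lparr>carrier := \<Lambda>\<rparr>)"
proof -
  have shift: "s = split_proj x - l * split_proj x"
    if "l \<in> \<Lambda>" "affine_act (- (inverse l * s), inverse l) x = x" for s l x
    using that \<Lambda>_pos[OF L M, of l] by (cases x) (auto simp: field_simps)
  have "x = x' \<and> s = s'"
    if "(x, s, l) \<in> carrier (isotropy (stein_groupoid \<Gamma> \<Lambda>) u)"
      "(x', s', l) \<in> carrier (isotropy (stein_groupoid \<Gamma> \<Lambda>) u)"
    for x s l x' s'
  proof -
    have "x' = x" "l \<in> \<Lambda>" "affine_act (- (inverse l * s), inverse l) x = x"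
        "affine_act (- (inverse l * s'), inverse l) x = x"
      using that by (auto simp: isotropy_def topspace_arrows_stein grange_stein gsource_stein)
    then show ?thesis using shift[of l s x] shift[of l s' x] by simp
  qed
  then have "inj_on (\<lambda>(x, s, l). l) (carrier (isotropy (stein_groupoid \<Gamma> \<Lambda>) u))"
    by (fastforce intro: inj_onI)
  then show ?thesis
    by (auto simp: mon_def hom_def isotropy_def topspace_arrows_stein pos_real_group_def)
      (auto simp: stein_groupoid_def transformation_groupoid_def affine_group_def)
qed

lemma isotropy_stein_Plus_zero_mon:
  "(\<lambda>l. (Plus 0, (0, l))) \<in>
     mon (pos_real_group\<lparr>carrier := \<Lambda>\<rparr>) (isotropy (stein_groupoid \<Gamma> \<Lambda>) (Plus 0, (0, 1)))"
  using \<Gamma>_zero[OF L M] \<Lambda>_one[OF L M]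
  by (auto simp: mon_def hom_def inj_on_def isotropy_def topspace_arrows_stein grange_stein
      gsource_stein split_line_def pos_real_group_def)
    (auto simp: stein_groupoid_def transformation_groupoid_def affine_group_def)

lemma stein_mult_closed:
  assumes "g \<in> topspace (arrows (stein_groupoid \<Gamma> \<Lambda>))" and "h \<in> topspace (arrows (stein_groupoid \<Gamma> \<Lambda>))"
  shows "gmult (stein_groupoid \<Gamma> \<Lambda>) g h \<in> topspace (arrows (stein_groupoid \<Gamma> \<Lambda>))"
  using assms \<Gamma>_add[OF L M] \<Gamma>_scale[OF L M] \<Lambda>_mult[OF L M]
  by (auto simp: stein_groupoid_def transformation_groupoid_def affine_group_def)

end

text \<open>The embedding is a composition of three: \<open>\<Lambda>1\<close> into the isotropy group at \<open>Plus 0\<close>, that group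
  into the isotropy group at its image under \<open>f\<close>, and the latter into \<open>\<Lambda>2\<close> by linear parts.\<close>

lemma stein_iso_imp_mon:
  assumes L1: "subgroup \<Lambda>1 pos_real_group" and M1: "real_module \<Lambda>1 \<Gamma>1"
    and L2: "subgroup \<Lambda>2 pos_real_group" and M2: "real_module \<Lambda>2 \<Gamma>2"
    and f: "top_groupoid_iso (stein_groupoid \<Gamma>1 \<Lambda>1) (stein_groupoid \<Gamma>2 \<Lambda>2) f"
  shows "\<exists>h. h \<in> mon (pos_real_group\<lparr>carrier := \<Lambda>1\<rparr>) (pos_real_group\<lparr>carrier := \<Lambda>2\<rparr>)"
  using mon_compose[OF mon_compose[OF isotropy_stein_Plus_zero_mon[OF L1 M1]
      top_groupoid_iso_isotropy_mon[OF f]] isotropy_stein_mon[OF L2 M2]] by blast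

theorem lemma3p7:
  fixes \<Lambda>1 \<Lambda>2 \<Gamma>1 \<Gamma>2 :: "real set"
  assumes "subgroup \<Lambda>1 pos_real_group" and "countable \<Lambda>1"
    and "real_module \<Lambda>1 \<Gamma>1" and "countable \<Gamma>1" and "closure \<Gamma>1 = UNIV"
    and "subgroup \<Lambda>2 pos_real_group" and "countable \<Lambda>2"
    and "real_module \<Lambda>2 \<Gamma>2" and "countable \<Gamma>2" and "closure \<Gamma>2 = UNIV"
    and "isomorphic_top_groupoids (stein_groupoid \<Gamma>1 \<Lambda>1) (stein_groupoid \<Gamma>2 \<Lambda>2)"
    and "finitely_generated_group (pos_real_group\<lparr>carrier := \<Lambda>1\<rparr>)"
  shows "pos_real_group\<lparr>carrier := \<Lambda>1\<rparr> \<cong> pos_real_group\<lparr>carrier := \<Lambda>2\<rparr>"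
proof -
  note L1 = assms(1) and M1 = assms(3) and L2 = assms(6) and M2 = assms(8)
  obtain f where f: "top_groupoid_iso (stein_groupoid \<Gamma>1 \<Lambda>1) (stein_groupoid \<Gamma>2 \<Lambda>2) f"
    using assms(11) by (auto simp: isomorphic_top_groupoids_def)
  obtain f' where f': "top_groupoid_iso (stein_groupoid \<Gamma>2 \<Lambda>2) (stein_groupoid \<Gamma>1 \<Lambda>1) f'"
    using top_groupoid_iso_inverse[OF f stein_range_source_closed[OF L1 M1] stein_mult_closed[OF L1 M1]]
    by blast
  obtain h k
    where "h \<in> mon (pos_real_group\<lparr>carrier := \<Lambda>1\<rparr>) (pos_real_group\<lparr>carrier := \<Lambda>2\<rparr>)"
      and "k \<in> mon (pos_real_group\<lparr>carrier := \<Lambda>2\<rparr>) (pos_real_group\<lparr>carrier := \<Lambda>1\<rparr>)"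
    using stein_iso_imp_mon[OF L1 M1 L2 M2 f] stein_iso_imp_mon[OF L2 M2 L1 M1 f'] by blast
  then show ?thesis by (rule finitely_generated_iso_of_mutual_mon[OF L1 L2 assms(12)])
qed

end
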